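(* Let $\mathcal H$ and $\mathcal G$ be real Hilbert spaces, let $A\colon\mathcal H\to2^{\mathcal H}$ and $B\colon\mathcal G\to2^{\mathcal G}$ be maximally monotone operators, and let $L\colon\mathcal H\to\mathcal G$ be a bounded linear operator. Let $\mathscr P$, $\mathscr D$, $\boldsymbol Z$ be the primal solution set, dual solution set and Kuhn-Tucker set defined in the context. Suppose that $\mathscr P\neq\varnothing$, let $\varepsilon\in\left]0,1\right[$, let $x_0\in\mathcal H$, let $v_0^*\in\mathcal G$, and iterate as follows for $n=0,1,\dots$: 1. Choose any $(\gamma_n,\mu_n)\in[\varepsilon,1/\varepsilon]^2$ and set $a_n=J_{\gamma_nA}(x_n-\gamma_nL^*v_n^* )$, $\;l_n=Lx_n$, $\;b_n=J_{\mu_nB}(l_n+\mu_nv_n^* )$, $\;s_n^*=\gamma_n^{-1}(x_n-a_n)+\mu_n^{-1}L^*(l_n-b_n)$, $\;t_n=b_n-La_n$, $\;\tau_n=\|s_n^*\|^2+\|t_n\|^2$. 2. If $\tau_n=0$: set $\overline x=a_n$, $\overline v^*=v_n^*+\mu_n^{-1}(l_n-b_n)$, and terminate. 3. If $\tau_n>0$: choose any $\lambda_n\in[\varepsilon,2-\varepsilon]$ and set $\theta_n=\lambda_n\big(\gamma_n^{-1}\|x_n-a_n\|^2+\mu_n^{-1}\|l_n-b_n\|^2\big)/\tau_n$, $\;x_{n+1}=x_n-\theta_ns_n^*$, $\;v_{n+1}^*=v_n^*-\theta_nt_n$. Then either the iteration terminates in a finite number of steps at a point $(\overline x,\overline v^*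 )\in\boldsymbol Z$, or it generates infinite sequences $(x_n)_{n\in\mathbb N}$ and $(v_n^* )_{n\in\mathbb N}$ such that the following hold: (i) $\sum_{n\in\mathbb N}\|s_n^*\|^2<+\infty$ and $\sum_{n\in\mathbb N}\|t_n\|^2<+\infty$. (ii) $\sum_{n\in\mathbb N}\|x_{n+1}-x_n\|^2<+\infty$ and $\sum_{n\in\mathbb N}\|v^*_{n+1}-v^*_n\|^2<+\infty$. (iii) $\sum_{n\in\mathbb N}\|x_n-a_n\|^2<+\infty$ and $\sum_{n\in\mathbb N}\|Lx_n-b_n\|^2<+\infty$. (iv) $(x_n)_{n\in\mathbb N}$ converges weakly to a point $\overline x\in\mathscr P$, $(v_n^* )_{n\in\mathbb N}$ converges weakly to a point $\overline v^*\in\mathscr D$, and $(\overline x,\overline v^* )\in\boldsymbol Z$.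
   Context: For a maximally monotone operator $M$ on a real Hilbert space and $\gamma>0$, $J_{\gamma M}=(\mathrm{Id}+\gamma M)^{-1}$ is the resolvent, which is single-valued and defined everywhere. $M^{-1}$ is the inverse set-valued operator: $x\in M^{-1}u\Leftrightarrow u\in Mx$. $\mathscr P=\{x\in\mathcal H\mid 0\in Ax+L^*BLx\}$, where $L^*BLx=\{L^*w\mid w\in B(Lx)\}$, is the primal solution set. $\mathscr D=\{v^*\in\mathcal G\mid 0\in-LA^{-1}(-L^*v^* )+B^{-1}v^*\}$ is the dual solution set, where $LA^{-1}(-L^*v^* )=\{Lu\mid u\in A^{-1}(-L^*v^* )\}$. The Kuhn-Tucker set is $\boldsymbol Z=\{(x,v^* )\in\mathcal H\oplus\mathcal G\mid -L^*v^*\in Ax\text{ and }Lx\in B^{-1}v^*\}$. *)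

theory Defs
  imports "HOL-Analysis.Analysis" "HOL-Library.Set_Algebras"
begin

text \<open>
  A set-valued operator on a space \<open>'a\<close> is a function \<open>'a \<Rightarrow> 'a set\<close>. Real Hilbert spaces are types
  of sort \<open>{real_inner, complete_space}\<close>. The sum of two sets is the Minkowski sum of
  \<open>HOL-Library.Set_Algebras\<close>.
\<close>

definition op_inverse :: "('a \<Rightarrow> 'b set) \<Rightarrow> 'b \<Rightarrow> 'a set" where
  "op_inverse M u = {x. u \<in> M x}"

definition monotone_op :: "('a::real_inner \<Rightarrow> 'a set) \<Rightarrow> bool" where
  "monotone_op M \<longleftrightarrow> (\<forall>x y. \<forall>u\<in>M x. \<forall>v\<in>M y. 0 \<le> (x - y) \<bullet> (u - v))"

definition maximally_monotone :: "('a::real_inner \<Rightarrow> 'a set) \<Rightarrow> bool" where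
  "maximally_monotone M \<longleftrightarrow>
     monotone_op M \<and> (\<forall>N. monotone_op N \<and> (\<forall>x. M x \<subseteq> N x) \<longrightarrow> N = M)"

text \<open>
  The resolvent \<open>(Id + \<gamma>M)\<inverse>\<close>, as a function. The description is proper when \<open>M\<close> is
  maximally monotone and \<open>\<gamma> > 0\<close> (Minty's theorem); otherwise the value may be unspecified.
\<close>

definition resolvent :: "real \<Rightarrow> ('a::real_inner \<Rightarrow> 'a set) \<Rightarrow> 'a \<Rightarrow> 'a" where
  "resolvent \<gamma> M x = (THE p. p \<in> op_inverse (\<lambda>y. {y} + (\<lambda>u. \<gamma> *\<^sub>R u) ` M y) x)"

definition primal_solutions ::
  "('a::real_inner \<Rightarrow> 'a set) \<Rightarrow> ('b::real_inner \<Rightarrow> 'b set) \<Rightarrow> ('a \<Rightarrow> 'b) \<Rightarrow> 'a set" where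
  "primal_solutions A B L = {x. 0 \<in> A x + adjoint L ` B (L x)}"

definition dual_solutions ::
  "('a::real_inner \<Rightarrow> 'a set) \<Rightarrow> ('b::real_inner \<Rightarrow> 'b set) \<Rightarrow> ('a \<Rightarrow> 'b) \<Rightarrow> 'b set" where
  "dual_solutions A B L =
     {v. 0 \<in> uminus ` (L ` op_inverse A (- adjoint L v)) + op_inverse B v}"

definition kuhn_tucker ::
  "('a::real_inner \<Rightarrow> 'a set) \<Rightarrow> ('b::real_inner \<Rightarrow> 'b set) \<Rightarrow> ('a \<Rightarrow> 'b) \<Rightarrow> ('a \<times> 'b) set" where
  "kuhn_tucker A B L = {(x, v). - adjoint L v \<in> A x \<and> L x \<in> op_inverse B v}"

definition weakly_converges :: "(nat \<Rightarrow> 'a::real_normed_vector) \<Rightarrow> 'a \<Rightarrow> bool" where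
  "weakly_converges x z \<longleftrightarrow>
     (\<forall>f :: 'a \<Rightarrow> real. bounded_linear f \<longrightarrow> (\<lambda>n. f (x n)) \<longlonglongrightarrow> f z)"

end

theory Submission
  imports Defs "HOL-Library.Diagonal_Subsequence"
begin

text \<open>
  With \<open>c n = s n - adjoint L (d n) \<in> A (a n)\<close> and \<open>d n = v n + inverse (\<mu> n) *\<^sub>R (l n - b n) \<in> B (b n)\<close>,
  monotonicity shows that the Kuhn-Tucker set lies in a half-space with normal \<open>(s n, t n)\<close>, and
  the update is a relaxed projection of \<open>(x n, v n)\<close> onto it. The iterates are therefore Fejer
  monotone with respect to the Kuhn-Tucker set, which yields all the summability claims, and Opial's
  argument reduces weak convergence to showing that weak cluster points are Kuhn-Tucker points.

  Both the Riesz representation theorem and Minty's theorem come from minimising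
  \<open>\<parallel>c\<parallel>\<^sup>2 + a\<close> over pairs \<open>(c, a)\<close> in a convex set \<open>K\<close>: minimising sequences are Cauchy in \<open>c\<close>, and the
  first-order condition at the limit is the desired conclusion. For Riesz \<open>K\<close> is the graph of \<open>- 2 f\<close>; for
  Minty it is the convex hull of the pairs \<open>((y - v) / 2, y \<bullet> v)\<close> with \<open>v \<in> M y\<close>.
\<close>

section \<open>Convex minimisation, Riesz and Minty\<close>

text \<open>The infimum \<open>S\<close> need not be attained on \<open>K\<close>, so the
  first-order condition is stated at the limit point \<open>(p, S - (norm p)\<^sup>2)\<close>: there
  the derivative of \<open>(norm c)\<^sup>2 + a\<close> towards any point of \<open>K\<close> is
  nonnegative.\<close>

lemma quadratic_minimizer:
  fixes K :: "('a::{real_inner, complete_space} \<times> real) set"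
  assumes "convex K" "K \<noteq> {}" and lower: "\<And>c a. (c, a) \<in> K \<Longrightarrow> m \<le> (norm c)\<^sup>2 + a"
  obtains p S where "p \<in> closure (fst ` K)" "m \<le> S"
    "\<And>c a. (c, a) \<in> K \<Longrightarrow> (norm p)\<^sup>2 + S \<le> 2 * (p \<bullet> c) + a"
proof -
  define q :: "'a \<times> real \<Rightarrow> real" where "q u = (norm (fst u))\<^sup>2 + snd u" for u
  define S where "S = Inf (q ` K)"
  have bdd: "bdd_below (q ` K)"
    by (rule bdd_belowI[where m=m]) (auto simp: q_def lower)
  have Sle: "S \<le> q u" if "u \<in> K" for u
    unfolding S_def by (rule cInf_lower) (use that bdd in auto)
  have mS: "m \<le> S"
    unfolding S_def by (rule cInf_greatest) (use assms in \<open>auto simp: q_def\<close>)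
  have "\<exists>u\<in>K. q u < S + inverse (real (Suc k))" for k
  proof -
    have "Inf (q ` K) < S + inverse (real (Suc k))"
      unfolding S_def by simp
    from cInf_lessD[OF _ this] show ?thesis using assms(2) by auto
  qed
  then obtain u where uK: "\<And>k. u k \<in> K" and uS: "\<And>k. q (u k) < S + inverse (real (Suc k))"
    by metis
  have comb: "(1 - r) *\<^sub>R y + r *\<^sub>R z \<in> K" if "y \<in> K" "z \<in> K" "0 \<le> r" "r \<le> 1" for y z r
    using convexD_alt[OF assms(1)] that by auto
  \<comment> \<open>Exact expansion along a segment; the coefficient of \<open>r\<close> is the
    directional derivative of \<open>q\<close> at \<open>y\<close>.\<close>
  have q_comb: "q ((1 - r) *\<^sub>R y + r *\<^sub>R z)
      = q y + r * (2 * (fst y \<bullet> fst z) - (norm (fst y))\<^sup>2 + snd z - q y)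
        + r\<^sup>2 * (norm (fst z - fst y))\<^sup>2" for y z :: "'a \<times> real" and r
    unfolding q_def power2_norm_eq_inner fst_add snd_add fst_scaleR snd_scaleR
    by (simp add: inner_add_left inner_add_right inner_diff_left inner_diff_right
        inner_commute[of "fst z" "fst y"] algebra_simps power2_eq_square)
  have close: "(norm (fst (u i) - fst (u j)))\<^sup>2 \<le> 4 * inverse (real (Suc N))"
    if "N \<le> i" "N \<le> j" for i j N
  proof -
    \<comment> \<open>The midpoint stays in \<open>K\<close>, so its value is at least
      \<open>S\<close>; the parallelogram identity turns this into a distance bound.\<close>
    have "S \<le> q ((1 - 1/2) *\<^sub>R u i + (1/2) *\<^sub>R u j)"
      by (rule Sle, rule comb) (auto simp: uK)
    also have "\<dots> = (q (u i) + q (u j)) / 2 - (norm (fst (u i) - fst (u j)))\<^sup>2 / 4"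
      unfolding q_comb unfolding q_def power2_norm_eq_inner
      by (simp add: inner_diff_left inner_diff_right inner_commute[of "fst (u j)" "fst (u i)"]
          field_simps power2_eq_square)
    finally have "(norm (fst (u i) - fst (u j)))\<^sup>2 \<le> 2 * (q (u i) - S) + 2 * (q (u j) - S)"
      by (simp add: field_simps)
    also have "\<dots> \<le> 2 * inverse (real (Suc i)) + 2 * inverse (real (Suc j))"
      using uS[of i] uS[of j] by simp
    also have "\<dots> \<le> 2 * inverse (real (Suc N)) + 2 * inverse (real (Suc N))"
      using that by (intro add_mono mult_left_mono le_imp_inverse_le) auto
    finally show ?thesis by simp
  qed
  have "Cauchy (\<lambda>k. fst (u k))"
  proof (rule metric_CauchyI)
    fix e :: real assume "0 < e"
    then obtain N where N: "inverse (real (Suc N)) < e\<^sup>2 / 4"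
      using reals_Archimedean[of "e\<^sup>2 / 4"] by auto
    have "dist (fst (u i)) (fst (u j)) < e" if "N \<le> i" "N \<le> j" for i j
    proof -
      have "(norm (fst (u i) - fst (u j)))\<^sup>2 < e\<^sup>2"
        using close[OF that] N by linarith
      then show ?thesis
        unfolding dist_norm using \<open>0 < e\<close> by (meson power_less_imp_less_base less_imp_le)
    qed
    then show "\<exists>M. \<forall>m\<ge>M. \<forall>n\<ge>M. dist (fst (u m)) (fst (u n)) < e" by blast
  qed
  then obtain p where p: "(\<lambda>k. fst (u k)) \<longlonglongrightarrow> p"
    using Cauchy_convergent_iff convergent_def by blast
  have "(\<lambda>k. q (u k)) \<longlonglongrightarrow> S"
  proof (rule tendsto_sandwich[of "\<lambda>_. S" _ _ "\<lambda>k. S + inverse (real (Suc k))"])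
    show "(\<lambda>k. S + inverse (real (Suc k))) \<longlonglongrightarrow> S"
      using tendsto_add[OF tendsto_const LIMSEQ_inverse_real_of_nat] by simp
    show "\<forall>\<^sub>F k in sequentially. S \<le> q (u k)"
      using Sle uK by simp
    show "\<forall>\<^sub>F k in sequentially. q (u k) \<le> S + inverse (real (Suc k))"
      using uS by (intro always_eventually allI less_imp_le)
  qed simp
  have var: "(norm p)\<^sup>2 + S \<le> 2 * (p \<bullet> c) + a" if "(c, a) \<in> K" for c a
  proof -
    \<comment> \<open>\<open>X\<close> is the directional derivative at the limit. As that limit may
      lie outside \<open>K\<close>, minimality is used on segments starting at \<open>u k\<close>;
      then \<open>k\<close> tends to infinity, and after division by \<open>r\<close>,
      \<open>r\<close> tends to 0.\<close>
    define X where "X = 2 * (p \<bullet> c) - (norm p)\<^sup>2 + a - S"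
    have nn: "0 \<le> X + r * (norm (c - p))\<^sup>2" if r: "0 < r" "r \<le> 1" for r
    proof -
      have "S \<le> q (u k) + r * (2 * (fst (u k) \<bullet> c) - (norm (fst (u k)))\<^sup>2 + a - q (u k))
          + r\<^sup>2 * (norm (c - fst (u k)))\<^sup>2" for k
        using Sle[OF comb[OF uK[of k] \<open>(c, a) \<in> K\<close>, of r]] r unfolding q_comb by auto
      moreover have "(\<lambda>k. q (u k) + r * (2 * (fst (u k) \<bullet> c) - (norm (fst (u k)))\<^sup>2 + a - q (u k))
          + r\<^sup>2 * (norm (c - fst (u k)))\<^sup>2) \<longlonglongrightarrow> S + r * X + r\<^sup>2 * (norm (c - p))\<^sup>2"
        unfolding X_def by (intro tendsto_intros p \<open>(\<lambda>k. q (u k)) \<longlonglongrightarrow> S\<close>)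
      ultimately have "S \<le> S + r * X + r\<^sup>2 * (norm (c - p))\<^sup>2"
        by (meson LIMSEQ_le_const)
      then have "0 \<le> r * (X + r * (norm (c - p))\<^sup>2)"
        by (simp add: algebra_simps power2_eq_square)
      then show ?thesis using r by (simp add: zero_le_mult_iff)
    qed
    have "((\<lambda>r. X + r * (norm (c - p))\<^sup>2) \<longlongrightarrow> X + 0 * (norm (c - p))\<^sup>2) (at_right 0)"
      by (intro tendsto_intros)
    moreover have "\<forall>\<^sub>F r in at_right (0::real). 0 \<le> X + r * (norm (c - p))\<^sup>2"
      unfolding eventually_at_right_field using nn by (intro exI[of _ 1]) auto
    ultimately have "0 \<le> X"
      using tendsto_lowerbound[of "\<lambda>r. X + r * (norm (c - p))\<^sup>2" _ "at_right (0::real)" 0] by simp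
    then show ?thesis by (simp add: X_def)
  qed
  have "p \<in> closure (fst ` K)"
    unfolding closure_sequential using p uK by (intro exI[of _ "\<lambda>k. fst (u k)"]) auto
  with mS var that show ?thesis by blast
qed

text \<open>\<open>p\<close> minimises \<open>(norm x)\<^sup>2 - 2 * f x\<close> over
  \<open>D\<close>. Linearity and boundedness are asked on \<open>D\<close> alone because one
  application is to a limit functional controlled only where the limits exist; another yields
  orthogonal projections onto \<open>D\<close>.\<close>

lemma riesz_representation_on:
  fixes D :: "'a::{real_inner, complete_space} set" and f :: "'a \<Rightarrow> real"
  assumes D: "subspace D" "closed D"
    and add: "\<And>x y. x \<in> D \<Longrightarrow> y \<in> D \<Longrightarrow> f (x + y) = f x + f y"
    and scale: "\<And>r x. x \<in> D \<Longrightarrow> f (r *\<^sub>R x) = r * f x"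
    and bound: "\<And>x. x \<in> D \<Longrightarrow> \<bar>f x\<bar> \<le> C * norm x"
  obtains p where "p \<in> D" "\<And>x. x \<in> D \<Longrightarrow> f x = p \<bullet> x"
proof -
  define K where "K = (\<lambda>x. (x, - 2 * f x)) ` D"
  have "convex K"
    unfolding convex_alt
  proof (clarsimp simp: K_def)
    fix x y and r :: real assume "x \<in> D" "y \<in> D"
    then have "(1 - r) *\<^sub>R x + r *\<^sub>R y \<in> D"
      "f ((1 - r) *\<^sub>R x + r *\<^sub>R y) = (1 - r) * f x + r * f y"
      using D(1) by (simp_all add: add scale subspace_add subspace_scale)
    then show "((1 - r) *\<^sub>R x + r *\<^sub>R y, - ((1 - r) * (2 * f x)) - r * (2 * f y))
        \<in> (\<lambda>x. (x, - (2 * f x))) ` D"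
      by (intro image_eqI[of _ _ "(1 - r) *\<^sub>R x + r *\<^sub>R y"]) (auto simp: algebra_simps)
  qed
  moreover have "K \<noteq> {}" using subspace_0[OF D(1)] by (auto simp: K_def)
  moreover have "- C\<^sup>2 \<le> (norm c)\<^sup>2 + a" if "(c, a) \<in> K" for c a
  proof -
    have c: "c \<in> D" "a = - 2 * f c" using that by (auto simp: K_def)
    have "0 \<le> (norm c - C)\<^sup>2" by simp
    moreover have "f c \<le> C * norm c" using bound[OF c(1)] by linarith
    ultimately show ?thesis using c(2) by (simp add: power2_diff mult.commute)
  qed
  ultimately obtain p S where p: "p \<in> closure (fst ` K)"
    and var: "\<And>c a. (c, a) \<in> K \<Longrightarrow> (norm p)\<^sup>2 + S \<le> 2 * (p \<bullet> c) + a"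
    by (elim quadratic_minimizer) auto
  have "fst ` K = D" by (force simp: K_def)
  with p D(2) have "p \<in> D" by simp
  have "f x = p \<bullet> x" if "x \<in> D" for x
  proof (rule ccontr)
    define e where "e = p \<bullet> x - f x"
    assume "f x \<noteq> p \<bullet> x"
    then have "e \<noteq> 0" by (simp add: e_def)
    \<comment> \<open>\<open>D\<close> contains all multiples of \<open>x\<close>, so a linear
      function of \<open>r\<close> is bounded below on the whole line and has slope 0. The
      \<open>r\<close> chosen below makes the right side
      \<open>(norm p)\<^sup>2 + S - 1\<close>.\<close>
    have low: "(norm p)\<^sup>2 + S \<le> 2 * (r * e)" for r
    proof -
      have "(r *\<^sub>R x, - 2 * f (r *\<^sub>R x)) \<in> K"
        using that D(1) by (auto simp: K_def subspace_scale)
      from var[OF this] that show ?thesis by (simp add: scale e_def algebra_simps)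
    qed
    show False
      using low[of "((norm p)\<^sup>2 + S - 1) / (2 * e)"] \<open>e \<noteq> 0\<close> by simp
  qed
  with \<open>p \<in> D\<close> that show ?thesis by blast
qed

corollary riesz_representation:
  fixes f :: "'a::{real_inner, complete_space} \<Rightarrow> real"
  assumes "bounded_linear f"
  obtains p where "\<And>x. f x = p \<bullet> x"
proof -
  interpret bounded_linear f by fact
  obtain C where C: "\<And>x. \<bar>f x\<bar> \<le> C * norm x" using bounded by (auto simp: mult.commute)
  obtain p where "\<And>x. x \<in> UNIV \<Longrightarrow> f x = p \<bullet> x"
    by (rule riesz_representation_on[OF subspace_UNIV closed_UNIV, of f C])
      (auto simp: add scaleR C)
  with that show ?thesis by blast
qed

section \<open>Adjoints of bounded linear operators\<close>

lemma inner_adjoint: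
  fixes L :: "'a::{real_inner, complete_space} \<Rightarrow> 'b::real_inner"
  assumes "bounded_linear L"
  shows "x \<bullet> adjoint L y = L x \<bullet> y"
proof -
  \<comment> \<open>\<open>adjoint\<close> is a Hilbert choice, so some adjoint must first be shown
    to exist; Riesz supplies its value at each \<open>y\<close>.\<close>
  have "\<exists>w. \<forall>x. L x \<bullet> y = x \<bullet> w" for y
  proof -
    have "bounded_linear (\<lambda>x. L x \<bullet> y)"
      using bounded_linear_compose[OF bounded_linear_inner_left assms] .
    then show ?thesis
      by (metis riesz_representation inner_commute)
  qed
  then have "\<exists>g. \<forall>x y. L x \<bullet> y = x \<bullet> g y" by metis
  then have "\<forall>x y. L x \<bullet> y = x \<bullet> adjoint L y"
    unfolding adjoint_def by (rule someI_ex)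
  then show ?thesis by simp
qed

lemma bounded_linear_adjoint:
  fixes L :: "'a::{real_inner, complete_space} \<Rightarrow> 'b::real_inner"
  assumes "bounded_linear L"
  shows "bounded_linear (adjoint L)"
proof -
  obtain K where K: "\<And>x. norm (L x) \<le> norm x * K" "0 \<le> K"
    using bounded_linear.nonneg_bounded[OF assms] by blast
  show ?thesis
  proof (rule bounded_linear_intro)
    show "adjoint L (y + z) = adjoint L y + adjoint L z" for y z
      by (subst vector_eq_ldot[symmetric]) (simp add: inner_add_right inner_adjoint[OF assms])
    show "adjoint L (r *\<^sub>R y) = r *\<^sub>R adjoint L y" for r y
      by (subst vector_eq_ldot[symmetric]) (simp add: inner_adjoint[OF assms])
    show "norm (adjoint L y) \<le> norm y * K" for y
    proof (cases "adjoint L y = 0")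
      case False
      have "norm (adjoint L y) * norm (adjoint L y) = L (adjoint L y) \<bullet> y"
        by (simp add: inner_adjoint[OF assms, symmetric] power2_norm_eq_inner[symmetric]
            power2_eq_square)
      also have "\<dots> \<le> norm (L (adjoint L y)) * norm y" by (rule norm_cauchy_schwarz)
      also have "\<dots> \<le> norm (adjoint L y) * K * norm y" by (intro mult_right_mono K) simp
      finally show ?thesis using False by (simp add: mult.assoc mult.commute)
    qed (use K in simp)
  qed
qed

text \<open>The two-step use of convexity below yields \<open>y \<bullet> v \<le> a\<close> on the convex hull: freeze one of
  the two graph points in the monotonicity inequality, extend the other to the hull, and swap.\<close>

lemma monotone_graph_ball_intersection:
  fixes G :: "('a::{real_inner, complete_space} \<times> 'a) set"
  assumes mono: "\<And>y v y' v'. (y, v) \<in> G \<Longrightarrow> (y', v') \<in> G \<Longrightarrow> 0 \<le> (y - y') \<bullet> (v - v')"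
  obtains p where "\<And>y v. (y, v) \<in> G \<Longrightarrow> (p - y) \<bullet> (p + v) \<le> 0"
proof (cases "G = {}")
  case False
  define T where "T = convex hull ((\<lambda>(y, v). (y, v, y \<bullet> v)) ` G)"
  \<comment> \<open>With one pair fixed, the monotonicity inequality is affine in the lifted triple
    \<open>(y, v, y \<bullet> v)\<close>; it cuts out a half-space and so passes to the hull
    \<open>T\<close>.\<close>
  have half: "convex {(y, v, a). 0 \<le> a - y \<bullet> v0 - y0 \<bullet> v + (c::real)}" for v0 y0 :: 'a and c
  proof -
    have "{(y, v, a). 0 \<le> a - y \<bullet> v0 - y0 \<bullet> v + c} =
        {z. (v0, y0, - 1) \<bullet> z \<le> c}"
      by (auto simp: inner_prod_def inner_commute)
    then show ?thesis by (simp add: convex_halfspace_le)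
  qed
  have TG: "0 \<le> a - y \<bullet> v0 - y0 \<bullet> v + y0 \<bullet> v0" if "(y, v, a) \<in> T" "(y0, v0) \<in> G" for y v a y0 v0
  proof -
    have "T \<subseteq> {(y, v, a). 0 \<le> a - y \<bullet> v0 - y0 \<bullet> v + y0 \<bullet> v0}"
      unfolding T_def
      using mono[OF _ that(2)]
      by (intro hull_minimal half) (force simp: inner_diff_left inner_diff_right algebra_simps)
    then show ?thesis using that(1) by auto
  qed
  have TT: "0 \<le> a' - y' \<bullet> v - y \<bullet> v' + a" if "(y, v, a) \<in> T" "(y', v', a') \<in> T" for y v a y' v' a'
  proof -
    have "T \<subseteq> {(y', v', a'). 0 \<le> a' - y' \<bullet> v - y \<bullet> v' + a}"
      unfolding T_def
      by (intro hull_minimal half) (use TG[OF that(1)] in force)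
    then show ?thesis using that(2) by auto
  qed
  have Tge: "y \<bullet> v \<le> a" if "(y, v, a) \<in> T" for y v a
    using TT[OF that that] by simp
  define K where "K = (\<lambda>(y, v, a). ((1/2) *\<^sub>R (y - v), a)) ` T"
  have "linear (\<lambda>(y :: 'a, v, a :: real). ((1/2) *\<^sub>R (y - v), a))"
    by (rule linearI) (auto simp: algebra_simps)
  then have "convex K"
    unfolding K_def T_def by (intro convex_linear_image convex_convex_hull)
  moreover have "K \<noteq> {}" using False by (simp add: K_def T_def)
  moreover have "0 \<le> (norm c)\<^sup>2 + a" if cK: "(c, a) \<in> K" for c a
  proof -
    obtain y v where yv: "(y, v, a) \<in> T" "c = (1/2) *\<^sub>R (y - v)"
      using cK by (auto simp: K_def)
    have "(norm c)\<^sup>2 + y \<bullet> v = (norm ((1/2) *\<^sub>R (y + v)))\<^sup>2"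
      unfolding yv(2) power2_norm_eq_inner
      by (simp add: inner_add_left inner_add_right inner_diff_left inner_diff_right
          inner_commute[of v y] algebra_simps)
    also have "\<dots> \<ge> 0" by simp
    finally show ?thesis using Tge[OF yv(1)] by linarith
  qed
  ultimately obtain p S where S: "0 \<le> S"
    and var: "\<And>c a. (c, a) \<in> K \<Longrightarrow> (norm p)\<^sup>2 + S \<le> 2 * (p \<bullet> c) + a"
    by (elim quadratic_minimizer) auto
  have "(p - y) \<bullet> (p + v) \<le> 0" if "(y, v) \<in> G" for y v
  proof -
    have "(y, v, y \<bullet> v) \<in> T"
      unfolding T_def by (rule hull_inc) (use that in auto)
    then have "((1/2) *\<^sub>R (y - v), y \<bullet> v) \<in> K" by (force simp: K_def)
    \<comment> \<open>Dropping \<open>S \<ge> 0\<close> leaves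
      \<open>(norm p)\<^sup>2 \<le> p \<bullet> (y - v) + y \<bullet> v\<close>, which factors into
      the claim: \<open>p\<close> lies in the ball with diameter from \<open>y\<close> to
      \<open>- v\<close>.\<close>
    from var[OF this] S show ?thesis
      by (simp add: power2_norm_eq_inner inner_add_left inner_add_right inner_diff_left
          inner_diff_right inner_commute[of y p] field_simps)
  qed
  with that show ?thesis by blast
qed (use that in auto)

section \<open>Maximality, Minty's theorem and resolvents\<close>

lemma maximally_monotone_memI:
  assumes M: "maximally_monotone M"
    and rel: "\<And>y v. v \<in> M y \<Longrightarrow> 0 \<le> (x - y) \<bullet> (u - v)"
  shows "u \<in> M x"
proof -
  \<comment> \<open>Adjoining \<open>(x, u)\<close> to the graph keeps it monotone by
    \<open>rel\<close>, so maximality forces \<open>N = M\<close>.\<close>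
  define N where "N y = (if y = x then insert u (M y) else M y)" for y
  have rel': "0 \<le> (y - x) \<bullet> (v - u)" if "v \<in> M y" for y v
  proof -
    have "(y - x) \<bullet> (v - u) = (x - y) \<bullet> (u - v)" by (simp add: inner_diff_left inner_diff_right)
    with rel[OF that] show ?thesis by simp
  qed
  have "monotone_op M" using M by (simp add: maximally_monotone_def)
  then have "monotone_op N"
    using rel rel' unfolding monotone_op_def N_def by (auto split: if_splits)
  moreover have "\<forall>y. M y \<subseteq> N y" by (auto simp: N_def)
  ultimately have "N = M" using M unfolding maximally_monotone_def by blast
  moreover have "u \<in> N x" by (simp add: N_def)
  ultimately show ?thesis by simp
qed

text \<open>The ball lemma is applied to the graph of \<open>g M - x\<close>. Divided by
  \<open>- g\<close>, its inequality says that \<open>(p, inverse g *\<^sub>R (x - p))\<close> is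
  monotonically related to the graph of \<open>M\<close>, and maximality applies.\<close>

theorem minty:
  fixes M :: "'a::{real_inner, complete_space} \<Rightarrow> 'a set"
  assumes M: "maximally_monotone M" and "0 < g"
  shows "\<exists>p. inverse g *\<^sub>R (x - p) \<in> M p"
proof -
  have mono: "0 \<le> (y - y') \<bullet> (v - v')" if "v \<in> M y" "v' \<in> M y'" for y y' v v'
    using M that unfolding maximally_monotone_def monotone_op_def by blast
  define G where "G = {(y, w). \<exists>v\<in>M y. w = g *\<^sub>R v - x}"
  have "0 \<le> (y - y') \<bullet> (w - w')" if G: "(y, w) \<in> G" "(y', w') \<in> G" for y w y' w'
  proof -
    obtain v v' where v: "v \<in> M y" "v' \<in> M y'" "w = g *\<^sub>R v - x" "w' = g *\<^sub>R v' - x"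
      using G by (auto simp: G_def)
    then have "w - w' = g *\<^sub>R (v - v')" by (simp only: v) (simp add: algebra_simps)
    then show ?thesis using mono[OF v(1,2)] \<open>0 < g\<close> by simp
  qed
  then obtain p where p: "\<And>y w. (y, w) \<in> G \<Longrightarrow> (p - y) \<bullet> (p + w) \<le> 0"
    using monotone_graph_ball_intersection by blast
  have "inverse g *\<^sub>R (x - p) \<in> M p"
  proof (rule maximally_monotone_memI[OF M])
    fix y v assume "v \<in> M y"
    then have "(p - y) \<bullet> (p + (g *\<^sub>R v - x)) \<le> 0" by (intro p) (auto simp: G_def)
    moreover have "p + (g *\<^sub>R v - x) = - g *\<^sub>R (inverse g *\<^sub>R (x - p) - v)"
      using \<open>0 < g\<close> by (simp add: algebra_simps)
    ultimately show "0 \<le> (p - y) \<bullet> (inverse g *\<^sub>R (x - p) - v)"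
      using \<open>0 < g\<close> by (simp add: zero_le_mult_iff)
  qed
  then show ?thesis by blast
qed

text \<open>Justifies the definite description: Minty gives existence, and for two candidates
  monotonicity reads \<open>0 \<le> - inverse g * (norm (p - p'))\<^sup>2\<close>.\<close>

lemma resolvent_mem:
  fixes M :: "'a::{real_inner, complete_space} \<Rightarrow> 'a set"
  assumes M: "maximally_monotone M" and "0 < g"
  shows "inverse g *\<^sub>R (x - resolvent g M x) \<in> M (resolvent g M x)"
proof -
  let ?P = "\<lambda>p. inverse g *\<^sub>R (x - p) \<in> M p"
  have eq: "p \<in> op_inverse (\<lambda>y. {y} + (\<lambda>u. g *\<^sub>R u) ` M y) x \<longleftrightarrow> ?P p" for p
  proof -
    have "x = p + g *\<^sub>R u \<longleftrightarrow> u = inverse g *\<^sub>R (x - p)" for u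
      using \<open>0 < g\<close> by (metis add_diff_cancel_left' diff_add_cancel
          divideR_right less_irrefl)
    then show ?thesis by (auto simp: op_inverse_def set_plus_def)
  qed
  have uniq: "p = p'" if "?P p" "?P p'" for p p'
  proof -
    have "0 \<le> (p - p') \<bullet> (inverse g *\<^sub>R (x - p) - inverse g *\<^sub>R (x - p'))"
      using M that unfolding maximally_monotone_def monotone_op_def by blast
    also have "inverse g *\<^sub>R (x - p) - inverse g *\<^sub>R (x - p') = - inverse g *\<^sub>R (p - p')"
      by (simp add: algebra_simps)
    finally have "(p - p') \<bullet> (p - p') \<le> 0"
      using \<open>0 < g\<close> by (simp add: mult_le_0_iff)
    then show ?thesis by (metis inner_gt_zero_iff not_less right_minus_eq)
  qed
  have "\<exists>!p. ?P p" using minty[OF assms] uniq by blast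
  then show ?thesis
    unfolding resolvent_def eq by (rule theI')
qed

section \<open>Weak convergence and Opial's lemma\<close>

lemma weakly_converges_iff_inner:
  fixes w :: "nat \<Rightarrow> 'a::{real_inner, complete_space}"
  shows "weakly_converges w z \<longleftrightarrow> (\<forall>y. (\<lambda>n. w n \<bullet> y) \<longlonglongrightarrow> z \<bullet> y)"
proof
  assume "weakly_converges w z"
  then show "\<forall>y. (\<lambda>n. w n \<bullet> y) \<longlonglongrightarrow> z \<bullet> y"
    unfolding weakly_converges_def using bounded_linear_inner_left by blast
next
  assume lim: "\<forall>y. (\<lambda>n. w n \<bullet> y) \<longlonglongrightarrow> z \<bullet> y"
  show "weakly_converges w z"
    unfolding weakly_converges_def
  proof (intro allI impI)
    fix f :: "'a \<Rightarrow> real" assume "bounded_linear f"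
    then obtain p where "\<And>x. f x = p \<bullet> x" using riesz_representation by blast
    with lim show "(\<lambda>n. f (w n)) \<longlonglongrightarrow> f z" by (simp add: inner_commute)
  qed
qed

text \<open>Lets Opial's argument treat primal and dual iterates together in the product
  space.\<close>

lemma weakly_converges_Pair_iff:
  fixes x :: "nat \<Rightarrow> 'a::{real_inner, complete_space}"
    and v :: "nat \<Rightarrow> 'b::{real_inner, complete_space}"
  shows "weakly_converges (\<lambda>n. (x n, v n)) (y, q) \<longleftrightarrow> weakly_converges x y \<and> weakly_converges v q"
    (is "?L \<longleftrightarrow> ?R")
proof
  assume L: ?L
  have "(\<lambda>n. x n \<bullet> c) \<longlonglongrightarrow> y \<bullet> c" "(\<lambda>n. v n \<bullet> d) \<longlonglongrightarrow> q \<bullet> d" for c d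
    using L[unfolded weakly_converges_iff_inner, rule_format, of "(c, 0)"]
      L[unfolded weakly_converges_iff_inner, rule_format, of "(0, d)"] by simp_all
  then show ?R by (simp add: weakly_converges_iff_inner)
next
  assume ?R
  then show ?L by (auto simp: weakly_converges_iff_inner intro: tendsto_add)
qed

lemma weakly_converges_add_null:
  fixes p q :: "nat \<Rightarrow> 'a::{real_inner, complete_space}"
  assumes "weakly_converges p z" "q \<longlonglongrightarrow> 0"
  shows "weakly_converges (\<lambda>n. p n + q n) z"
proof -
  have "(\<lambda>n. p n \<bullet> y + q n \<bullet> y) \<longlonglongrightarrow> z \<bullet> y + 0 \<bullet> y" for y
    using assms(1) unfolding weakly_converges_iff_inner
    by (intro tendsto_add tendsto_inner[OF assms(2)] tendsto_const) blast
  then show ?thesis by (simp add: weakly_converges_iff_inner inner_add_left)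
qed

text \<open>Testing against the countably many vectors \<open>w k\<close> permits a diagonal
  argument; each refinement comes from Bolzano-Weierstrass for bounded scalars.\<close>

lemma bounded_imp_diagonal_inner_convergent:
  fixes w :: "nat \<Rightarrow> 'a::real_inner"
  assumes "bounded (range w)"
  obtains r :: "nat \<Rightarrow> nat" where "strict_mono r" "\<And>k. convergent (\<lambda>n. w (r n) \<bullet> w k)"
proof -
  obtain C where C: "\<And>n. norm (w n) \<le> C" using assms by (auto simp: bounded_iff)
  interpret subseqs "\<lambda>k r. convergent (\<lambda>n. w (r n) \<bullet> w k)"
  proof
    fix k and s :: "nat \<Rightarrow> nat"
    have "bounded (range (\<lambda>n. w (s n) \<bullet> w k))"
    proof (rule boundedI)
      fix u assume "u \<in> range (\<lambda>n. w (s n) \<bullet> w k)"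
      then obtain n where "u = w (s n) \<bullet> w k" by auto
      then have "norm u \<le> norm (w (s n)) * norm (w k)" using Cauchy_Schwarz_ineq2 by auto
      also have "\<dots> \<le> C * norm (w k)" by (intro mult_right_mono C) simp
      finally show "norm u \<le> C * norm (w k)" .
    qed
    then obtain c and r' :: "nat \<Rightarrow> nat" where "strict_mono r'"
        "((\<lambda>n. w (s n) \<bullet> w k) \<circ> r') \<longlonglongrightarrow> c"
      using bounded_imp_convergent_subsequence by blast
    then show "\<exists>r'. strict_mono r' \<and> convergent (\<lambda>n. w ((s \<circ> r') n) \<bullet> w k)"
      by (auto simp: comp_def convergent_def)
  qed
  have "convergent (\<lambda>n. w (diagseq n) \<bullet> w k)" for k
  proof -
    \<comment> \<open>Property \<open>k\<close> is guaranteed for the diagonal sequence from index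
      \<open>Suc k\<close> on; the initial segment is dropped afterwards.\<close>
    have "convergent (\<lambda>n. w ((diagseq \<circ> ((+) (Suc k))) n) \<bullet> w k)"
    proof (rule diagseq_holds)
      fix r s :: "nat \<Rightarrow> nat" and k
      assume "strict_mono r" "convergent (\<lambda>n. w (s n) \<bullet> w k)"
      then show "convergent (\<lambda>n. w ((s \<circ> r) n) \<bullet> w k)"
        using convergent_subseq_convergent[of "\<lambda>n. w (s n) \<bullet> w k" r] by (simp add: comp_def)
    qed
    then show ?thesis
      using convergent_ignore_initial_segment[of "\<lambda>n. w (diagseq n) \<bullet> w k" "Suc k"]
      by (simp add: add.commute)
  qed
  with subseq_diagseq that show ?thesis by blast
qed

text \<open>The vectors against which the diagonal subsequence converges form a closed subspace
  \<open>D\<close> containing the sequence. Subtracting from \<open>y\<close> its projection on \<open>D\<close> leaves a vector orthogonal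
  to the sequence, so \<open>D\<close> is the whole space.\<close>

theorem bounded_imp_weakly_convergent_subsequence:
  fixes w :: "nat \<Rightarrow> 'a::{real_inner, complete_space}"
  assumes "bounded (range w)"
  obtains z and r :: "nat \<Rightarrow> nat" where "strict_mono r" "weakly_converges (w \<circ> r) z"
proof -
  obtain C where C: "\<And>n. norm (w n) \<le> C" using assms by (auto simp: bounded_iff)
  then have "0 \<le> C" using norm_ge_zero order_trans by blast
  obtain r :: "nat \<Rightarrow> nat" where r: "strict_mono r" "\<And>k. convergent (\<lambda>n. w (r n) \<bullet> w k)"
    using bounded_imp_diagonal_inner_convergent[OF assms] by blast
  define D where "D = {y. convergent (\<lambda>n. w (r n) \<bullet> y)}"
  define f where "f y = lim (\<lambda>n. w (r n) \<bullet> y)" for y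
  have lim_f: "(\<lambda>n. w (r n) \<bullet> y) \<longlonglongrightarrow> f y" if "y \<in> D" for y
    using that by (simp add: D_def f_def convergent_LIMSEQ_iff)
  have in_D: "y \<in> D" "f y = c" if "(\<lambda>n. w (r n) \<bullet> y) \<longlonglongrightarrow> c" for y c
    using that by (auto simp: D_def f_def convergent_def limI)
  have sum_lim: "(\<lambda>n. w (r n) \<bullet> (y + y')) \<longlonglongrightarrow> f y + f y'" if "y \<in> D" "y' \<in> D" for y y'
    unfolding inner_add_right using that by (intro tendsto_intros lim_f)
  have scale_lim: "(\<lambda>n. w (r n) \<bullet> (c *\<^sub>R y)) \<longlonglongrightarrow> c * f y" if "y \<in> D" for y c
    unfolding inner_scaleR_right using that by (intro tendsto_intros lim_f)
  have inner_le: "\<bar>w n \<bullet> y\<bar> \<le> C * norm y" for n y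
    by (rule order_trans[OF Cauchy_Schwarz_ineq2]) (intro mult_right_mono C norm_ge_zero)
  have "subspace D"
    by (rule subspaceI) (auto intro: in_D[OF sum_lim] in_D[OF scale_lim] in_D[of 0 0])
  have "closed D"
    unfolding closed_sequential_limits
  proof clarify
    fix y z assume y: "\<forall>k. y k \<in> D" "y \<longlonglongrightarrow> z"
    have "Cauchy (\<lambda>n. w (r n) \<bullet> z)"
    proof (rule metric_CauchyI)
      fix e :: real assume "0 < e"
      have "(\<lambda>k. C * norm (z - y k)) \<longlonglongrightarrow> C * norm (z - z)"
        by (intro tendsto_intros y)
      then have "\<forall>\<^sub>F k in sequentially. C * norm (z - y k) < e / 3"
        using \<open>0 < e\<close> by (intro order_tendstoD) auto
      then obtain k where k: "C * norm (z - y k) < e / 3" by (auto simp: eventually_sequentially)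
      have "Cauchy (\<lambda>n. w (r n) \<bullet> y k)"
        using y(1) by (auto simp: D_def Cauchy_convergent_iff)
      then obtain N where N: "\<And>m n. N \<le> m \<Longrightarrow> N \<le> n \<Longrightarrow>
          dist (w (r m) \<bullet> y k) (w (r n) \<bullet> y k) < e / 3"
        using metric_CauchyD[of _ "e / 3"] \<open>0 < e\<close> by (metis divide_pos_pos zero_less_numeral)
      have "dist (w (r m) \<bullet> z) (w (r n) \<bullet> z) < e" if "N \<le> m" "N \<le> n" for m n
        using N[OF that] inner_le[of "r m" "z - y k"] inner_le[of "r n" "z - y k"] k
        unfolding dist_real_def inner_diff_right by linarith
      then show "\<exists>M. \<forall>m\<ge>M. \<forall>n\<ge>M. dist (w (r m) \<bullet> z) (w (r n) \<bullet> z) < e" by blast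
    qed
    then show "z \<in> D" by (simp add: D_def Cauchy_convergent_iff)
  qed
  \<comment> \<open>The future weak limit: the representer on \<open>D\<close> of the limit
    functional, whose bound \<open>C\<close> is inherited from the sequence.\<close>
  obtain p where p: "p \<in> D" "\<And>y. y \<in> D \<Longrightarrow> f y = p \<bullet> y"
  proof (rule riesz_representation_on[OF \<open>subspace D\<close> \<open>closed D\<close>, of f C])
    show "\<bar>f y\<bar> \<le> C * norm y" if "y \<in> D" for y
      by (rule LIMSEQ_le_const2[OF tendsto_rabs[OF lim_f[OF that]]]) (use inner_le in auto)
  qed (use in_D(2)[OF sum_lim] in_D(2)[OF scale_lim] in auto)
  have "y \<in> D" for y
  proof -
    \<comment> \<open>Riesz on \<open>D\<close> for \<open>(\<bullet>) y\<close> produces the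
      orthogonal projection \<open>d\<close> of \<open>y\<close>.\<close>
    obtain d where d: "d \<in> D" "\<And>x. x \<in> D \<Longrightarrow> y \<bullet> x = d \<bullet> x"
      by (rule riesz_representation_on[OF \<open>subspace D\<close> \<open>closed D\<close>, of "(\<bullet>) y" "norm y"])
        (auto simp: inner_add_right Cauchy_Schwarz_ineq2)
    have "w k \<in> D" for k using r(2) by (simp add: D_def)
    then have "w (r n) \<bullet> (y - d) = 0" for n
      using d(2)[of "w (r n)"] by (simp add: inner_commute[of "w (r n)"] inner_diff_left)
    then have "y - d \<in> D" by (intro in_D(1)[of _ 0]) simp
    with d(1) \<open>subspace D\<close> show ?thesis using subspace_add by fastforce
  qed
  then have "weakly_converges (w \<circ> r) p"
    using lim_f p(2) by (simp add: weakly_converges_iff_inner)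
  with r(1) that show ?thesis by blast
qed

lemma bounded_if_dist_square_convergent:
  fixes w :: "nat \<Rightarrow> 'a::real_normed_vector"
  assumes "convergent (\<lambda>n. (norm (w n - z))\<^sup>2)"
  shows "bounded (range w)"
proof -
  obtain K where "\<And>n. norm ((norm (w n - z))\<^sup>2) \<le> K"
    using assms convergent_imp_Bseq BseqE by blast
  then have "(norm (w n - z))\<^sup>2 \<le> K" for n by simp
  then have "norm (w n - z) \<le> sqrt K" for n using real_le_rsqrt by blast
  then have "norm (w n) \<le> norm z + sqrt K" for n
    by (metis add.commute add_mono_thms_linordered_semiring(1) diff_add_cancel
        norm_triangle_ineq order.refl order.trans)
  then show ?thesis by (auto simp: bounded_iff)
qed

text \<open>Opial's argument: \<open>w n \<bullet> (z - z')\<close> converges for \<open>z, z' \<in> Z\<close>, because it is an affine function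
  of \<open>\<parallel>w n - z\<parallel>\<^sup>2 - \<parallel>w n - z'\<parallel>\<^sup>2\<close>; hence all weak cluster points coincide.\<close>

theorem opial:
  fixes w :: "nat \<Rightarrow> 'a::{real_inner, complete_space}"
  assumes "Z \<noteq> {}"
    and dist_conv: "\<And>z. z \<in> Z \<Longrightarrow> convergent (\<lambda>n. (norm (w n - z))\<^sup>2)"
    and cluster: "\<And>(r :: nat \<Rightarrow> nat) z. strict_mono r \<Longrightarrow> weakly_converges (w \<circ> r) z \<Longrightarrow> z \<in> Z"
  obtains z where "z \<in> Z" "weakly_converges w z"
proof -
  have "bounded (range w)"
    using assms(1) dist_conv bounded_if_dist_square_convergent by blast
  have sub: "\<exists>z r'. strict_mono r' \<and> weakly_converges (w \<circ> (r \<circ> r')) z"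
    if "strict_mono r" for r :: "nat \<Rightarrow> nat"
  proof -
    have "bounded (range (w \<circ> r))"
      by (rule bounded_subset[OF \<open>bounded (range w)\<close>]) auto
    then show ?thesis
      by (metis bounded_imp_weakly_convergent_subsequence comp_assoc)
  qed
  have unique: "z = z'"
    if "strict_mono r" "weakly_converges (w \<circ> r) z" "strict_mono r'" "weakly_converges (w \<circ> r') z'"
    for r r' :: "nat \<Rightarrow> nat" and z z'
  proof -
    have "z \<in> Z" "z' \<in> Z" using that cluster by blast+
    then have "convergent (\<lambda>n. (1/2) * ((norm (w n - z'))\<^sup>2 - (norm (w n - z))\<^sup>2
        + (norm z)\<^sup>2 - (norm z')\<^sup>2))"
      using dist_conv by (intro convergent_mult convergent_diff convergent_add convergent_const)
    moreover have "(1/2) * ((norm (w n - z'))\<^sup>2 - (norm (w n - z))\<^sup>2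
        + (norm z)\<^sup>2 - (norm z')\<^sup>2) = w n \<bullet> (z - z')" for n
      by (simp add: power2_norm_eq_inner inner_diff_left inner_diff_right inner_commute)
    ultimately obtain c where c: "(\<lambda>n. w n \<bullet> (z - z')) \<longlonglongrightarrow> c" by (auto simp: convergent_def)
    have "z \<bullet> (z - z') = c" "z' \<bullet> (z - z') = c"
      using that LIMSEQ_subseq_LIMSEQ[OF c]
      unfolding weakly_converges_iff_inner comp_def by (meson LIMSEQ_unique)+
    then have "(z - z') \<bullet> (z - z') = 0" by (simp add: inner_diff_left)
    then show ?thesis by simp
  qed
  obtain z and r0 :: "nat \<Rightarrow> nat" where r0: "strict_mono r0" "weakly_converges (w \<circ> r0) z"
    using bounded_imp_weakly_convergent_subsequence[OF \<open>bounded (range w)\<close>] by blast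
  have "(\<lambda>n. w n \<bullet> y) \<longlonglongrightarrow> z \<bullet> y" for y
  proof (rule ccontr)
    assume "\<not> (\<lambda>n. w n \<bullet> y) \<longlonglongrightarrow> z \<bullet> y"
    then obtain e where "0 < e" and e: "\<And>N. \<exists>n\<ge>N. e \<le> dist (w n \<bullet> y) (z \<bullet> y)"
      unfolding lim_sequentially by (meson not_le)
    \<comment> \<open>The indices at distance at least \<open>e\<close> form a subsequence; it has a
      weakly convergent refinement, whose limit must be \<open>z\<close> by uniqueness, a
      contradiction.\<close>
    define S where "S = {n. e \<le> dist (w n \<bullet> y) (z \<bullet> y)}"
    have "infinite S" unfolding infinite_nat_iff_unbounded_le S_def using e by blast
    then have "strict_mono (enumerate S)" by (rule strict_mono_enumerate)
    with sub obtain z' and r' :: "nat \<Rightarrow> nat" where r': "strict_mono r'"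
        "weakly_converges (w \<circ> (enumerate S \<circ> r')) z'" by blast
    then have "z' = z"
      using unique[OF strict_mono_o[OF \<open>strict_mono (enumerate S)\<close> r'(1)] r'(2) r0] by simp
    with r'(2) have "(\<lambda>n. w (enumerate S (r' n)) \<bullet> y) \<longlonglongrightarrow> z \<bullet> y"
      by (simp add: weakly_converges_iff_inner)
    then obtain n where "dist (w (enumerate S (r' n)) \<bullet> y) (z \<bullet> y) < e"
      using \<open>0 < e\<close> unfolding lim_sequentially by blast
    moreover have "enumerate S (r' n) \<in> S" using \<open>infinite S\<close> by (rule enumerate_in_set)
    ultimately show False by (simp add: S_def)
  qed
  then have "weakly_converges w z" by (simp add: weakly_converges_iff_inner)
  with cluster[OF r0] that show ?thesis by blast
qed

lemma summable_if_telescoping_bound: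
  fixes d q :: "nat \<Rightarrow> real"
  assumes "0 < c" "\<And>n. 0 \<le> d n" "\<And>n. 0 \<le> q n" and step: "\<And>n. d (Suc n) \<le> d n - c * q n"
  shows "summable q"
proof (rule summableI_nonneg_bounded)
  have tel: "c * (\<Sum>i<n. q i) \<le> d 0 - d n" for n
  proof (induction n)
    case (Suc n)
    then show ?case using step[of n] by (simp add: distrib_left)
  qed simp
  show "(\<Sum>i<n. q i) \<le> d 0 / c" for n
    using tel[of n] assms(1,2) by (simp add: field_simps) (smt (verit))
qed (use assms in auto)

section \<open>Kuhn-Tucker points and the projection step\<close>

lemma kuhn_tuckerI:
  "- adjoint L v \<in> A x \<Longrightarrow> v \<in> B (L x) \<Longrightarrow> (x, v) \<in> kuhn_tucker A B L"
  by (simp add: kuhn_tucker_def op_inverse_def)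

lemma kuhn_tuckerD:
  assumes "(x, v) \<in> kuhn_tucker A B L"
  shows "- adjoint L v \<in> A x" "v \<in> B (L x)"
  using assms by (simp_all add: kuhn_tucker_def op_inverse_def)

text \<open>Provides the reference point that the Fejer argument needs when only a primal solution
  is given.\<close>

lemma primal_imp_kuhn_tucker:
  assumes "x \<in> primal_solutions A B L"
  obtains v where "(x, v) \<in> kuhn_tucker A B L"
proof -
  obtain u v where "u \<in> A x" "v \<in> B (L x)" "0 = u + adjoint L v"
    using assms by (auto simp: primal_solutions_def set_plus_def)
  then have "- adjoint L v \<in> A x" by (metis minus_unique add.commute minus_minus)
  then show ?thesis using \<open>v \<in> B (L x)\<close> kuhn_tuckerI that by blast
qed

lemma kuhn_tucker_imp_primal:
  assumes "(x, v) \<in> kuhn_tucker A B L"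
  shows "x \<in> primal_solutions A B L"
proof -
  have "- adjoint L v + adjoint L v \<in> A x + adjoint L ` B (L x)"
    using kuhn_tuckerD[OF assms] by (intro set_plus_intro imageI)
  then show ?thesis by (simp add: primal_solutions_def)
qed

lemma kuhn_tucker_imp_dual:
  assumes "(x, v) \<in> kuhn_tucker A B L"
  shows "v \<in> dual_solutions A B L"
proof -
  have "- L x + L x \<in> uminus ` (L ` op_inverse A (- adjoint L v)) + op_inverse B v"
    using kuhn_tuckerD[OF assms]
    by (intro set_plus_intro imageI) (auto simp: op_inverse_def)
  then show ?thesis by (simp add: dual_solutions_def)
qed

text \<open>In the sum of the monotonicity inequalities of \<open>A\<close> at \<open>a\<close>,
  \<open>x\<close> and of \<open>B\<close> at \<open>b\<close>, \<open>L x\<close>, the terms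
  \<open>L x \<bullet> v\<close> cancel, so the result is affine in \<open>(x, v)\<close>.\<close>

lemma kuhn_tucker_halfspace:
  fixes L :: "'a::{real_inner, complete_space} \<Rightarrow> 'b::real_inner"
  assumes "monotone_op A" "monotone_op B" "bounded_linear L"
    and "c \<in> A a" "d \<in> B b" and z: "(x, v) \<in> kuhn_tucker A B L"
  shows "x \<bullet> (c + adjoint L d) + (b - L a) \<bullet> v \<le> a \<bullet> c + b \<bullet> d"
proof -
  have "0 \<le> (a - x) \<bullet> (c - - adjoint L v)"
    using assms(1,4) kuhn_tuckerD(1)[OF z] unfolding monotone_op_def by blast
  moreover have "0 \<le> (b - L x) \<bullet> (d - v)"
    using assms(2,5) kuhn_tuckerD(2)[OF z] unfolding monotone_op_def by blast
  ultimately show ?thesis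
    by (simp add: inner_diff_left inner_diff_right inner_add_right inner_adjoint[OF assms(3)]
        linear_diff[OF bounded_linear.linear[OF assms(3)]])
qed

lemma tendsto_inner_bounded_null:
  fixes p q :: "nat \<Rightarrow> 'a::real_inner"
  assumes "bounded (range p)" "q \<longlonglongrightarrow> 0"
  shows "(\<lambda>n. p n \<bullet> q n) \<longlonglongrightarrow> 0"
proof -
  obtain C where C: "\<And>n. norm (p n) \<le> C" using assms(1) by (auto simp: bounded_iff)
  have "norm (p n \<bullet> q n) \<le> C * norm (q n)" for n
    unfolding real_norm_def
    by (rule order_trans[OF Cauchy_Schwarz_ineq2]) (intro mult_right_mono C norm_ge_zero)
  moreover have "(\<lambda>n. C * norm (q n)) \<longlonglongrightarrow> 0"
    using tendsto_mult_right_zero[OF tendsto_norm_zero[OF assms(2)]] .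
  ultimately show ?thesis by (rule Lim_null_comparison[OF always_eventually[OF allI]])
qed

text \<open>The products \<open>a n \<bullet> c n\<close> and \<open>b n \<bullet> d n\<close> of weakly convergent sequences need not converge, but
  the coupling through \<open>L\<close> makes their sum \<open>a n \<bullet> (c n + adjoint L (d n)) + (b n - L (a n)) \<bullet> d n\<close>
  vanish in the limit.\<close>

lemma kuhn_tucker_weakly_closed:
  fixes L :: "'a::{real_inner, complete_space} \<Rightarrow> 'b::{real_inner, complete_space}"
  assumes A: "maximally_monotone A" and B: "maximally_monotone B" and L: "bounded_linear L"
    and cA: "\<And>n. c n \<in> A (a n)" and dB: "\<And>n. d n \<in> B (b n)"
    and bdd: "bounded (range a)" "bounded (range d)"
    and wa: "weakly_converges a x" and wd: "weakly_converges d v"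
    and s0: "(\<lambda>n. c n + adjoint L (d n)) \<longlonglongrightarrow> 0" and t0: "(\<lambda>n. b n - L (a n)) \<longlonglongrightarrow> 0"
  shows "(x, v) \<in> kuhn_tucker A B L"
proof -
  have wa': "(\<lambda>n. a n \<bullet> y) \<longlonglongrightarrow> x \<bullet> y" and wd': "(\<lambda>n. d n \<bullet> q) \<longlonglongrightarrow> v \<bullet> q" for y q
    using wa wd by (auto simp: weakly_converges_iff_inner)
  \<comment> \<open>Only the sum of the two products survives the limit; nonnegativity of each one
    separately is not yet available.\<close>
  have lim: "0 \<le> (x - y) \<bullet> (- adjoint L v - u) + (L x - w) \<bullet> (v - q)"
    if u: "u \<in> A y" and q: "q \<in> B w" for y u w q
  proof -
    let ?s = "\<lambda>n. c n + adjoint L (d n)" and ?t = "\<lambda>n. b n - L (a n)"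
    have eq: "(a n - y) \<bullet> (c n - u) + (b n - w) \<bullet> (d n - q) =
        a n \<bullet> ?s n + d n \<bullet> ?t n - a n \<bullet> u - y \<bullet> ?s n + d n \<bullet> L y + y \<bullet> u - q \<bullet> ?t n
        - a n \<bullet> adjoint L q - d n \<bullet> w + w \<bullet> q" for n
      by (simp add: inner_diff_left inner_diff_right inner_add_left inner_add_right
          inner_adjoint[OF L] inner_commute)
    have "0 \<le> (a n - y) \<bullet> (c n - u)" "0 \<le> (b n - w) \<bullet> (d n - q)" for n
      using A B cA[of n] dB[of n] u q unfolding maximally_monotone_def monotone_op_def by blast+
    then have "0 \<le> (a n - y) \<bullet> (c n - u) + (b n - w) \<bullet> (d n - q)" for n
      by (rule add_nonneg_nonneg)
    moreover have "(\<lambda>n. (a n - y) \<bullet> (c n - u) + (b n - w) \<bullet> (d n - q)) \<longlonglongrightarrow>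
        0 + 0 - x \<bullet> u - y \<bullet> 0 + v \<bullet> L y + y \<bullet> u - q \<bullet> 0 - x \<bullet> adjoint L q - v \<bullet> w + w \<bullet> q"
      unfolding eq
      by (intro tendsto_add tendsto_diff tendsto_const wa' wd' tendsto_inner_bounded_null bdd s0 t0
          tendsto_inner[OF tendsto_const s0] tendsto_inner[OF tendsto_const t0])
    ultimately have "0 \<le> 0 + 0 - x \<bullet> u - y \<bullet> 0 + v \<bullet> L y + y \<bullet> u - q \<bullet> 0
        - x \<bullet> adjoint L q - v \<bullet> w + w \<bullet> q"
      by (meson LIMSEQ_le_const)
    then show ?thesis
      by (simp add: inner_diff_left inner_diff_right inner_adjoint[OF L] inner_commute
          linear_diff[OF bounded_linear.linear[OF L]])
  qed
  have memA: "- adjoint L v \<in> A x"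
  proof (rule ccontr)
    assume "- adjoint L v \<notin> A x"
    then obtain y u where u: "u \<in> A y" "(x - y) \<bullet> (- adjoint L v - u) < 0"
      using maximally_monotone_memI[OF A, of x "- adjoint L v"] by (meson not_le)
    \<comment> \<open>A violation for \<open>A\<close> forces strict positivity over the whole graph
      of \<open>B\<close>. By maximality \<open>(L x, v)\<close> is in that graph, and inserting it
      gives \<open>0 < 0\<close>.\<close>
    have "0 < (L x - w) \<bullet> (v - q)" if "q \<in> B w" for w q
      using lim[OF u(1) that] u(2) by linarith
    moreover from this have "v \<in> B (L x)"
      by (intro maximally_monotone_memI[OF B]) (simp add: less_imp_le)
    ultimately have "0 < (L x - L x) \<bullet> (v - v)" by blast
    then show False by simp
  qed
  have "v \<in> B (L x)"
    using lim[OF memA] by (intro maximally_monotone_memI[OF B]) simp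
  with memA show ?thesis by (rule kuhn_tuckerI)
qed

text \<open>\<open>\<Delta> / norm g\<close> is the distance from \<open>w\<close> to the half-space
  \<open>{z. \<Delta> \<le> (w - z) \<bullet> g}\<close>, and subtracting
  \<open>\<theta> *\<^sub>R g\<close> is the projection onto it relaxed by \<open>r\<close>. The
  decrease carries the factor \<open>r * (2 - r)\<close>, where \<open>r\<close> and
  \<open>2 - r\<close> are both at least \<open>e\<close>.\<close>

lemma relaxed_projection_step:
  fixes w g z :: "'a::real_inner"
  assumes "0 < e" "e \<le> r" "r \<le> 2 - e" and "g \<noteq> 0"
    and "0 \<le> \<Delta>" "\<Delta> \<le> (w - z) \<bullet> g" and \<theta>: "\<theta> = r * \<Delta> / (norm g)\<^sup>2"
  shows "(norm (w - \<theta> *\<^sub>R g - z))\<^sup>2 \<le> (norm (w - z))\<^sup>2 - e\<^sup>2 * (\<Delta>\<^sup>2 / (norm g)\<^sup>2)"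
    and "(norm (\<theta> *\<^sub>R g))\<^sup>2 \<le> 4 * (\<Delta>\<^sup>2 / (norm g)\<^sup>2)"
proof -
  define Q where "Q = \<Delta>\<^sup>2 / (norm g)\<^sup>2"
  have "0 \<le> Q" by (simp add: Q_def)
  have sq: "(norm (\<theta> *\<^sub>R g))\<^sup>2 = r\<^sup>2 * Q"
    using \<open>g \<noteq> 0\<close> by (simp add: \<theta> Q_def power_mult_distrib power_divide power2_eq_square)
  have "\<theta> * \<Delta> = r * Q" by (simp add: \<theta> Q_def power2_eq_square)
  moreover have "0 \<le> \<theta>" using assms by simp
  ultimately have lin: "r * Q \<le> \<theta> * ((w - z) \<bullet> g)"
    using assms(6) by (metis mult_left_mono)
  have "(norm (w - \<theta> *\<^sub>R g - z))\<^sup>2 = (norm ((w - z) - \<theta> *\<^sub>R g))\<^sup>2"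
    by (simp add: algebra_simps)
  also have "\<dots> = (norm (w - z))\<^sup>2 - 2 * (\<theta> * ((w - z) \<bullet> g)) + (norm (\<theta> *\<^sub>R g))\<^sup>2"
    unfolding power2_norm_eq_inner
    by (simp add: inner_diff_left inner_diff_right inner_commute[of g w] inner_commute[of g z]
        algebra_simps)
  also have "\<dots> \<le> (norm (w - z))\<^sup>2 - r * (2 - r) * Q"
    unfolding sq using lin by (simp add: algebra_simps power2_eq_square)
  also have "e * e \<le> r * (2 - r)"
    using assms by (intro mult_mono) auto
  then have "(norm (w - z))\<^sup>2 - r * (2 - r) * Q \<le> (norm (w - z))\<^sup>2 - e\<^sup>2 * Q"
    using \<open>0 \<le> Q\<close> by (simp add: mult_right_mono power2_eq_square)
  finally show "(norm (w - \<theta> *\<^sub>R g - z))\<^sup>2 \<le> (norm (w - z))\<^sup>2 - e\<^sup>2 * (\<Delta>\<^sup>2 / (norm g)\<^sup>2)"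
    by (simp add: Q_def)
  have "r\<^sup>2 \<le> 2\<^sup>2" using assms by (intro power_mono) auto
  then show "(norm (\<theta> *\<^sub>R g))\<^sup>2 \<le> 4 * (\<Delta>\<^sup>2 / (norm g)\<^sup>2)"
    unfolding sq using \<open>0 \<le> Q\<close> by (simp flip: Q_def add: mult_right_mono)
qed

section \<open>Bounds and inclusions for a single iteration\<close>

lemma power2_norm_add_le:
  fixes x y :: "'a::real_normed_vector"
  shows "(norm (x + y))\<^sup>2 \<le> 2 * ((norm x)\<^sup>2 + (norm y)\<^sup>2)"
proof -
  have "(norm (x + y))\<^sup>2 \<le> (norm x + norm y)\<^sup>2"
    by (intro power_mono norm_triangle_ineq) simp
  also have "\<dots> \<le> 2 * ((norm x)\<^sup>2 + (norm y)\<^sup>2)"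
    using sum_squares_bound[of "norm x" "norm y"] by (simp add: power2_sum)
  finally show ?thesis .
qed

text \<open>Used with \<open>p = x n - a n\<close>, \<open>q = l n - b n\<close>,
  \<open>p' = L p\<close>, \<open>q' = adjoint L q\<close>. The left side is then
  \<open>\<tau> n\<close>, so the residuals control the normal of the cut uniformly in
  \<open>n\<close>.\<close>

lemma cut_direction_bound:
  fixes p q' :: "'a::real_normed_vector" and q p' :: "'b::real_normed_vector"
  assumes "0 < e" "e \<le> g" "e \<le> m" "0 \<le> K"
    and q': "norm q' \<le> K * norm q" and p': "norm p' \<le> K * norm p"
  shows "(norm (inverse g *\<^sub>R p + inverse m *\<^sub>R q'))\<^sup>2 + (norm (p' - q))\<^sup>2
    \<le> 2 * (inverse (e\<^sup>2) + 1) * (1 + K\<^sup>2) * ((norm p)\<^sup>2 + (norm q)\<^sup>2)"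
proof -
  let ?e2 = "inverse (e\<^sup>2)"
  have inv: "(inverse k)\<^sup>2 \<le> ?e2" if "e \<le> k" for k
    unfolding power_inverse using assms that by (intro le_imp_inverse_le power_mono) auto
  have Tq: "(norm q')\<^sup>2 \<le> K\<^sup>2 * (norm q)\<^sup>2" and Lp: "(norm p')\<^sup>2 \<le> K\<^sup>2 * (norm p)\<^sup>2"
    using power_mono[OF q', of 2] power_mono[OF p', of 2] by (simp_all add: power_mult_distrib)
  have "(norm (inverse g *\<^sub>R p + inverse m *\<^sub>R q'))\<^sup>2
      \<le> 2 * ((inverse g)\<^sup>2 * (norm p)\<^sup>2 + (inverse m)\<^sup>2 * (norm q')\<^sup>2)"
    by (rule order_trans[OF power2_norm_add_le]) (simp add: power_mult_distrib power_inverse)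
  also have "\<dots> \<le> 2 * (?e2 * (norm p)\<^sup>2 + ?e2 * (K\<^sup>2 * (norm q)\<^sup>2))"
    using assms inv Tq by (intro mult_left_mono add_mono mult_mono) auto
  finally have 1: "(norm (inverse g *\<^sub>R p + inverse m *\<^sub>R q'))\<^sup>2
      \<le> 2 * ?e2 * ((norm p)\<^sup>2 + K\<^sup>2 * (norm q)\<^sup>2)" by (simp add: algebra_simps)
  have "(norm (p' - q))\<^sup>2 \<le> 2 * ((norm p')\<^sup>2 + (norm q)\<^sup>2)"
    using power2_norm_add_le[of p' "- q"] by simp
  with Lp have 2: "(norm (p' - q))\<^sup>2 \<le> 2 * (K\<^sup>2 * (norm p)\<^sup>2 + (norm q)\<^sup>2)" by simp
  define X where "X = (1 + K\<^sup>2) * ((norm p)\<^sup>2 + (norm q)\<^sup>2)"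
  have "(norm p)\<^sup>2 + K\<^sup>2 * (norm q)\<^sup>2 \<le> X" "K\<^sup>2 * (norm p)\<^sup>2 + (norm q)\<^sup>2 \<le> X"
    by (simp_all add: X_def algebra_simps)
  then have "2 * ?e2 * ((norm p)\<^sup>2 + K\<^sup>2 * (norm q)\<^sup>2) \<le> 2 * ?e2 * X"
    "2 * (K\<^sup>2 * (norm p)\<^sup>2 + (norm q)\<^sup>2) \<le> 2 * X"
    by (intro mult_left_mono; simp)+
  then have "(norm (inverse g *\<^sub>R p + inverse m *\<^sub>R q'))\<^sup>2 + (norm (p' - q))\<^sup>2
      \<le> 2 * ?e2 * X + 2 * X"
    using 1 2 by linarith
  then show ?thesis by (simp add: X_def algebra_simps)
qed

lemma summable_norm_square_imp_null:
  fixes h :: "nat \<Rightarrow> 'a::real_normed_vector"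
  assumes "summable (\<lambda>n. (norm (h n))\<^sup>2)"
  shows "h \<longlonglongrightarrow> 0"
  using tendsto_real_sqrt[OF summable_LIMSEQ_zero[OF assms]]
  by (simp add: tendsto_norm_zero_iff)

text \<open>The resolvents yield graph points, whose half-space inequality separates
  \<open>(x, v)\<close> from the Kuhn-Tucker set. Its excess at \<open>(x, v)\<close> is exactly the
  weighted sum of squared residuals.\<close>

lemma resolvent_iterate:
  fixes L :: "'a::{real_inner, complete_space} \<Rightarrow> 'b::{real_inner, complete_space}"
  assumes A: "maximally_monotone A" and B: "maximally_monotone B" and L: "bounded_linear L"
    and "0 < e" "e \<le> g" "e \<le> m"
    and a: "a = resolvent g A (x - g *\<^sub>R adjoint L v)"
    and l: "l = L x"
    and b: "b = resolvent m B (l + m *\<^sub>R v)"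
    and s: "s = inverse g *\<^sub>R (x - a) + inverse m *\<^sub>R adjoint L (l - b)"
  shows "s - adjoint L (v + inverse m *\<^sub>R (l - b)) \<in> A a" (is "?c \<in> _")
    and "v + inverse m *\<^sub>R (l - b) \<in> B b" (is "?d \<in> _")
    and "(y, q) \<in> kuhn_tucker A B L \<Longrightarrow>
      inverse g * (norm (x - a))\<^sup>2 + inverse m * (norm (l - b))\<^sup>2
        \<le> (x - y) \<bullet> s + (v - q) \<bullet> (b - L a)"
proof -
  interpret T: bounded_linear "adjoint L" by (rule bounded_linear_adjoint[OF L])
  have "0 < g" "0 < m" using assms by auto
  have c: "?c = inverse g *\<^sub>R (x - a) - adjoint L v" by (simp add: s T.add T.scaleR)
  have "inverse g *\<^sub>R (x - g *\<^sub>R adjoint L v - a) \<in> A a"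
    unfolding a by (rule resolvent_mem[OF A \<open>0 < g\<close>])
  moreover have "inverse g *\<^sub>R (x - g *\<^sub>R adjoint L v - a) = ?c"
    unfolding c using \<open>0 < g\<close> by (simp add: algebra_simps)
  ultimately show cA: "?c \<in> A a" by simp
  have "inverse m *\<^sub>R (l + m *\<^sub>R v - b) \<in> B b"
    unfolding b by (rule resolvent_mem[OF B \<open>0 < m\<close>])
  moreover have "inverse m *\<^sub>R (l + m *\<^sub>R v - b) = ?d"
    using \<open>0 < m\<close> by (simp add: algebra_simps)
  ultimately show dB: "?d \<in> B b" by simp
  assume kt: "(y, q) \<in> kuhn_tucker A B L"
  have "y \<bullet> s + (b - L a) \<bullet> q \<le> a \<bullet> ?c + b \<bullet> ?d"
    using kuhn_tucker_halfspace[OF _ _ L cA dB kt] A B by (simp add: maximally_monotone_def)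
  moreover have "a \<bullet> ?c + b \<bullet> ?d = a \<bullet> s + (b - L a) \<bullet> ?d"
    by (simp only: inner_diff_right inner_diff_left inner_adjoint[OF L])
  \<comment> \<open>Writing \<open>b - L a\<close> as \<open>(l - L a) - (l - b)\<close> makes the
    cross terms cancel.\<close>
  moreover have "(x - a) \<bullet> s + (v - ?d) \<bullet> (b - L a)
      = inverse g * (norm (x - a))\<^sup>2 + inverse m * (norm (l - b))\<^sup>2"
  proof -
    have "(x - a) \<bullet> s = inverse g * (norm (x - a))\<^sup>2 + inverse m * ((l - L a) \<bullet> (l - b))"
      unfolding s by (simp add: l inner_add_right inner_adjoint[OF L] power2_norm_eq_inner
          linear_diff[OF bounded_linear.linear[OF L]])
    moreover have "(v - ?d) \<bullet> (b - L a) = inverse m * ((l - b) \<bullet> (l - b) - (l - L a) \<bullet> (l - b))"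
      by (simp add: inner_diff_left inner_diff_right inner_commute algebra_simps)
    ultimately show ?thesis by (simp add: power2_norm_eq_inner algebra_simps)
  qed
  ultimately show "inverse g * (norm (x - a))\<^sup>2 + inverse m * (norm (l - b))\<^sup>2
        \<le> (x - y) \<bullet> s + (v - q) \<bullet> (b - L a)"
    unfolding inner_diff_left[of x] inner_commute[of _ "b - L a"] inner_diff_right[of "b - L a"]
    by linarith
qed

text \<open>The sequences are total functions; the guard \<open>\<forall>k<n. \<tau> k > 0\<close>
  restricts the rules to indices the iteration reaches, leaving entries after termination
  arbitrary.\<close>

theorem proposition3p5:
  fixes A :: "'a::{real_inner, complete_space} \<Rightarrow> 'a set"
    and B :: "'b::{real_inner, complete_space} \<Rightarrow> 'b set"
    and L :: "'a \<Rightarrow> 'b"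
    and \<epsilon> :: real
    and \<gamma> \<mu> lam \<tau> \<theta> :: "nat \<Rightarrow> real"
    and x a s :: "nat \<Rightarrow> 'a"
    and v l b t :: "nat \<Rightarrow> 'b"
  assumes "maximally_monotone A" and "maximally_monotone B"
    and "bounded_linear L"
    and "primal_solutions A B L \<noteq> {}"
    and "0 < \<epsilon>" and "\<epsilon> < 1"
    and step1: "\<And>n. (\<forall>k<n. \<tau> k > 0) \<Longrightarrow>
          \<gamma> n \<in> {\<epsilon>..1/\<epsilon>} \<and> \<mu> n \<in> {\<epsilon>..1/\<epsilon>} \<and>
          a n = resolvent (\<gamma> n) A (x n - \<gamma> n *\<^sub>R adjoint L (v n)) \<and>
          l n = L (x n) \<and>
          b n = resolvent (\<mu> n) B (l n + \<mu> n *\<^sub>R v n) \<and>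
          s n = inverse (\<gamma> n) *\<^sub>R (x n - a n) + inverse (\<mu> n) *\<^sub>R adjoint L (l n - b n) \<and>
          t n = b n - L (a n) \<and>
          \<tau> n = (norm (s n))\<^sup>2 + (norm (t n))\<^sup>2"
    and step3: "\<And>n. (\<forall>k<n. \<tau> k > 0) \<Longrightarrow> \<tau> n > 0 \<Longrightarrow>
          lam n \<in> {\<epsilon>..2 - \<epsilon>} \<and>
          \<theta> n = lam n * (inverse (\<gamma> n) * (norm (x n - a n))\<^sup>2 +
                         inverse (\<mu> n) * (norm (l n - b n))\<^sup>2) / \<tau> n \<and>
          x (Suc n) = x n - \<theta> n *\<^sub>R s n \<and>
          v (Suc n) = v n - \<theta> n *\<^sub>R t n"
  shows "(\<exists>n xbar vbar. (\<forall>k<n. \<tau> k > 0) \<and> \<tau> n = 0 \<and>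
            xbar = a n \<and> vbar = v n + inverse (\<mu> n) *\<^sub>R (l n - b n) \<and>
            (xbar, vbar) \<in> kuhn_tucker A B L)
       \<or> ((\<forall>n. \<tau> n > 0) \<and>
          (summable (\<lambda>n. (norm (s n))\<^sup>2) \<and> summable (\<lambda>n. (norm (t n))\<^sup>2)) \<and>
          (summable (\<lambda>n. (norm (x (Suc n) - x n))\<^sup>2) \<and>
           summable (\<lambda>n. (norm (v (Suc n) - v n))\<^sup>2)) \<and>
          (summable (\<lambda>n. (norm (x n - a n))\<^sup>2) \<and>
           summable (\<lambda>n. (norm (L (x n) - b n))\<^sup>2)) \<and>
          (\<exists>xbar vbar. weakly_converges x xbar \<and> xbar \<in> primal_solutions A B L \<and>
             weakly_converges v vbar \<and> vbar \<in> dual_solutions A B L \<and>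
             (xbar, vbar) \<in> kuhn_tucker A B L))"
proof (cases "\<forall>n. \<tau> n > 0")

  \<comment> \<open>Finite termination\<close>
  case False
  note A = assms(1) and B = assms(2) and L = assms(3)
  \<comment> \<open>At the first index with nonpositive \<open>\<tau>\<close> the rules of step 1
    still hold, and a sum of squares that is not positive vanishes.\<close>
  define n where "n = (LEAST n. \<not> \<tau> n > 0)"
  have pos: "\<forall>k<n. \<tau> k > 0" unfolding n_def using not_less_Least by blast
  note st = step1[OF pos]
  have "\<not> \<tau> n > 0" unfolding n_def using False by (metis (mono_tags) LeastI)
  moreover have "\<tau> n = (norm (s n))\<^sup>2 + (norm (t n))\<^sup>2" using st by blast
  ultimately have \<tau>: "\<tau> n = 0" and "(norm (s n))\<^sup>2 + (norm (t n))\<^sup>2 = 0"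
    using sum_power2_ge_zero[of "norm (s n)" "norm (t n)"] by simp_all
  \<comment> \<open>Vanishing \<open>s n\<close> and \<open>t n\<close> turn the two resolvent
    inclusions into the Kuhn-Tucker conditions.\<close>
  then have s0: "s n = 0" and t0: "t n = 0" by (auto simp: sum_power2_eq_zero_iff)
  define d where "d = v n + inverse (\<mu> n) *\<^sub>R (l n - b n)"
  note iter = resolvent_iterate[OF A B L, of \<epsilon> "\<gamma> n" "\<mu> n" "a n" "x n" "v n" "l n" "b n" "s n"]
  have "s n - adjoint L d \<in> A (a n)" "d \<in> B (b n)"
    unfolding d_def using iter st assms(5) by simp_all
  moreover have "b n = L (a n)" using t0 st by (metis right_minus_eq)
  ultimately have "(a n, d) \<in> kuhn_tucker A B L"
    using s0 by (intro kuhn_tuckerI) simp_all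
  with pos \<tau> show ?thesis
    by (intro disjI1 exI[of _ n] exI[of _ "a n"] exI[of _ d]) (simp add: d_def)
next

  \<comment> \<open>Infinite run: one step in the product space\<close>
  case True
  note A = assms(1) and B = assms(2) and L = assms(3)
  interpret L: bounded_linear L by (rule L)
  interpret T: bounded_linear "adjoint L" by (rule bounded_linear_adjoint[OF L])
  have \<tau>_pos: "0 < \<tau> n" for n using True by blast
  have st: "\<epsilon> \<le> \<gamma> n" "\<gamma> n \<le> 1/\<epsilon>" "\<epsilon> \<le> \<mu> n" "\<mu> n \<le> 1/\<epsilon>"
    "a n = resolvent (\<gamma> n) A (x n - \<gamma> n *\<^sub>R adjoint L (v n))" "l n = L (x n)"
    "b n = resolvent (\<mu> n) B (l n + \<mu> n *\<^sub>R v n)"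
    "s n = inverse (\<gamma> n) *\<^sub>R (x n - a n) + inverse (\<mu> n) *\<^sub>R adjoint L (l n - b n)"
    "t n = b n - L (a n)" "\<tau> n = (norm (s n))\<^sup>2 + (norm (t n))\<^sup>2" for n
    using step1[of n] True by auto
  define d where "d n = v n + inverse (\<mu> n) *\<^sub>R (l n - b n)" for n
  define \<Delta> where "\<Delta> n = inverse (\<gamma> n) * (norm (x n - a n))\<^sup>2 + inverse (\<mu> n) * (norm (l n - b n))\<^sup>2" for n
  define E where "E n = (norm (x n - a n))\<^sup>2 + (norm (l n - b n))\<^sup>2" for n
  \<comment> \<open>In the product space both updates become one relaxed projection, and
    \<open>\<tau> n\<close> is the squared norm of its normal.\<close>
  define w where "w n = (x n, v n)" for n
  define g where "g n = (s n, t n)" for n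
  let ?Q = "\<lambda>n. (\<Delta> n)\<^sup>2 / (norm (g n))\<^sup>2"
  have st3: "\<epsilon> \<le> lam n" "lam n \<le> 2 - \<epsilon>" "\<theta> n = lam n * \<Delta> n / \<tau> n"
    "x (Suc n) = x n - \<theta> n *\<^sub>R s n" "v (Suc n) = v n - \<theta> n *\<^sub>R t n" for n
    using step3[of n] True by (auto simp: \<Delta>_def)
  have g2: "(norm (g n))\<^sup>2 = \<tau> n" for n by (simp add: g_def norm_Pair st(10))
  have g_nz: "g n \<noteq> 0" for n using g2[of n] \<tau>_pos[of n] by auto
  have w_Suc: "w (Suc n) = w n - \<theta> n *\<^sub>R g n" for n by (simp add: w_def g_def st3)
  have cA: "s n - adjoint L (d n) \<in> A (a n)" and dB: "d n \<in> B (b n)"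
    and cut: "\<And>z. z \<in> kuhn_tucker A B L \<Longrightarrow> \<Delta> n \<le> (w n - z) \<bullet> g n" for n
  proof -
    note iter = resolvent_iterate[OF A B L assms(5) st(1)[of n] st(3)[of n] st(5)[of n] st(6)[of n]
        st(7)[of n] st(8)[of n]]
    show "s n - adjoint L (d n) \<in> A (a n)" "d n \<in> B (b n)"
      using iter(1,2) by (simp_all add: d_def)
    show "\<Delta> n \<le> (w n - z) \<bullet> g n" if "z \<in> kuhn_tucker A B L" for z
      using iter(3)[of "fst z" "snd z"] that
      by (cases z) (simp add: \<Delta>_def w_def g_def st(9))
  qed
  \<comment> \<open>The upper bound on the step sizes makes the weights in \<open>\<Delta>\<close>
    at least \<open>\<epsilon>\<close>; the lower bound enters through \<open>K\<close>
    below.\<close>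
  have inv: "\<epsilon> \<le> inverse k" if "0 < k" "k \<le> 1/\<epsilon>" for k
    using that assms(5) by (simp add: field_simps)
  have E\<Delta>: "\<epsilon> * E n \<le> \<Delta> n" and E_nn: "0 \<le> E n" for n
  proof -
    have "0 < \<gamma> n" "0 < \<mu> n" using st(1,3)[of n] assms(5) by auto
    then show "\<epsilon> * E n \<le> \<Delta> n"
      unfolding \<Delta>_def E_def distrib_left using st(2,4)
      by (intro add_mono mult_right_mono inv) auto
  qed (simp add: E_def)
  have \<Delta>_nn: "0 \<le> \<Delta> n" for n
    using E\<Delta>[of n] E_nn[of n] assms(5) by (smt (verit) mult_nonneg_nonneg)
  obtain K where "0 < K" and K: "(norm (g n))\<^sup>2 \<le> K * E n" for n
  proof -
    obtain K1 where K1: "0 \<le> K1" "\<And>y. norm (L y) \<le> norm y * K1" using L.nonneg_bounded by blast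
    obtain K2 where K2: "0 \<le> K2" "\<And>y. norm (adjoint L y) \<le> norm y * K2"
      using T.nonneg_bounded by blast
    define K where "K = K1 + K2"
    have Kb: "0 \<le> K" "norm (L y) \<le> K * norm y" "norm (adjoint L z) \<le> K * norm z" for y z
      using K1 K2 order_trans[OF K1(2)[of y]] order_trans[OF K2(2)[of z]]
      by (auto simp: K_def algebra_simps)
    have t: "norm (t n) = norm (L (x n - a n) - (l n - b n))" for n
      by (simp add: st(6,9) L.diff)
    have "(norm (g n))\<^sup>2 \<le> 2 * (inverse (\<epsilon>\<^sup>2) + 1) * (1 + K\<^sup>2) * E n" for n
      using cut_direction_bound[OF assms(5) st(1)[of n] st(3)[of n] Kb(1)
          Kb(3)[of "l n - b n"] Kb(2)[of "x n - a n"]]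
      unfolding g2 st(10) t E_def by (simp add: st(8))
    moreover have "0 < 2 * (inverse (\<epsilon>\<^sup>2) + 1) * (1 + K\<^sup>2)"
      by (intro mult_pos_pos add_pos_nonneg add_nonneg_pos) auto
    ultimately show ?thesis using that by blast
  qed

  \<comment> \<open>Fejer monotonicity and summability\<close>
  have fejer: "(norm (w (Suc n) - z))\<^sup>2 \<le> (norm (w n - z))\<^sup>2 - \<epsilon>\<^sup>2 * ?Q n"
    and step: "(norm (w (Suc n) - w n))\<^sup>2 \<le> 4 * ?Q n" if z: "z \<in> kuhn_tucker A B L" for n z
    using relaxed_projection_step[OF assms(5) st3(1,2) g_nz \<Delta>_nn cut[OF z], of "\<theta> n" n] st3(3)[of n]
    by (simp_all add: w_Suc g2)
  have "kuhn_tucker A B L \<noteq> {}"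
    using assms(4) primal_imp_kuhn_tucker by blast
  then obtain z where z: "z \<in> kuhn_tucker A B L" by blast
  have sumQ: "summable ?Q"
    by (rule summable_if_telescoping_bound[of "\<epsilon>\<^sup>2" "\<lambda>n. (norm (w n - z))\<^sup>2"])
      (use assms(5) fejer[OF z] in auto)
  \<comment> \<open>Since \<open>\<Delta> n\<close> is at least \<open>\<epsilon> * E n\<close> and
    the squared norm of \<open>g n\<close> at most \<open>K * E n\<close>, the quotient in
    \<open>?Q\<close> dominates a multiple of \<open>E n\<close>; thus summability passes to the
    residuals.\<close>
  have EQ: "E n \<le> K / \<epsilon>\<^sup>2 * ?Q n" for n
  proof -
    have "\<epsilon>\<^sup>2 * (E n * (norm (g n))\<^sup>2) \<le> \<epsilon>\<^sup>2 * (E n * (K * E n))"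
      by (intro mult_left_mono K E_nn) simp
    also have "\<dots> = K * (\<epsilon> * E n)\<^sup>2" by (simp add: power2_eq_square)
    also have "\<dots> \<le> K * (\<Delta> n)\<^sup>2"
      using \<open>0 < K\<close> assms(5) E_nn by (intro mult_left_mono power_mono E\<Delta>) auto
    finally show ?thesis
      using assms(5) \<tau>_pos[of n] by (simp add: g2 field_simps)
  qed
  have sumE: "summable E"
    by (rule summable_comparison_test'[OF summable_mult[OF sumQ, of "K / \<epsilon>\<^sup>2"], of 0])
      (unfold real_norm_def abs_of_nonneg[OF E_nn], rule EQ)
  have sumg: "summable (\<lambda>n. (norm (g n))\<^sup>2)"
    by (rule summable_comparison_test'[OF summable_mult[OF sumE, of K], of 0]) (use K in simp)
  have sumw: "summable (\<lambda>n. (norm (w (Suc n) - w n))\<^sup>2)"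
    by (rule summable_comparison_test'[OF summable_mult[OF sumQ, of 4], of 0])
      (use step[OF z] in simp)
  have sum_s: "summable (\<lambda>n. (norm (s n))\<^sup>2)" and sum_t: "summable (\<lambda>n. (norm (t n))\<^sup>2)"
    by (rule summable_comparison_test'[OF sumg, of 0], simp add: g2 st(10))+
  have sum_xs: "summable (\<lambda>n. (norm (x (Suc n) - x n))\<^sup>2)"
    and sum_vs: "summable (\<lambda>n. (norm (v (Suc n) - v n))\<^sup>2)"
    by (rule summable_comparison_test'[OF sumw, of 0], simp add: w_def norm_Pair)+
  have sum_xa: "summable (\<lambda>n. (norm (x n - a n))\<^sup>2)"
    and sum_lb: "summable (\<lambda>n. (norm (l n - b n))\<^sup>2)"
    by (rule summable_comparison_test'[OF sumE, of 0], simp add: E_def)+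

  \<comment> \<open>Weak convergence\<close>
  have dist_conv: "convergent (\<lambda>n. (norm (w n - z))\<^sup>2)" if "z \<in> kuhn_tucker A B L" for z
  proof (rule decseq_convergent[of _ 0])
    show "decseq (\<lambda>n. (norm (w n - z))\<^sup>2)"
      unfolding decseq_Suc_iff
    proof
      fix n
      have "0 \<le> \<epsilon>\<^sup>2 * ?Q n" by simp
      with fejer[OF that, of n] show "(norm (w (Suc n) - z))\<^sup>2 \<le> (norm (w n - z))\<^sup>2" by linarith
    qed
  qed (auto intro: convergentI)
  have ax0: "(\<lambda>n. a n - x n) \<longlonglongrightarrow> 0"
    using sum_xa by (intro summable_norm_square_imp_null) (simp add: norm_minus_commute)
  have lb0: "(\<lambda>n. l n - b n) \<longlonglongrightarrow> 0"
    using sum_lb by (rule summable_norm_square_imp_null)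
  \<comment> \<open>The residual \<open>l n - b n\<close> is scaled by at most
    \<open>inverse \<epsilon>\<close>, so \<open>d\<close> shares boundedness and weak cluster
    points with \<open>v\<close>, as \<open>a\<close> does with \<open>x\<close>.\<close>
  have dv0: "(\<lambda>n. d n - v n) \<longlonglongrightarrow> 0"
  proof (rule Lim_null_comparison[OF always_eventually[OF allI]])
    show "norm (d n - v n) \<le> inverse \<epsilon> * norm (l n - b n)" for n
      using st(3)[of n] assms(5) by (auto simp: d_def intro!: mult_right_mono le_imp_inverse_le)
    show "(\<lambda>n. inverse \<epsilon> * norm (l n - b n)) \<longlonglongrightarrow> 0"
      by (rule tendsto_mult_right_zero[OF tendsto_norm_zero[OF lb0]])
  qed
  have bdd: "bounded (range a)" "bounded (range d)"
  proof -
    have "bounded (range w)" using dist_conv[OF z] by (rule bounded_if_dist_square_convergent)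
    then have "bounded (range x)" "bounded (range v)"
      using bounded_fst[of "range w"] bounded_snd[of "range w"] by (simp_all add: w_def image_image)
    from bounded_plus_comp[OF this(1) convergent_imp_bounded[OF ax0]]
      bounded_plus_comp[OF this(2) convergent_imp_bounded[OF dv0]]
    show "bounded (range a)" "bounded (range d)" by simp_all
  qed
  obtain z where z: "z \<in> kuhn_tucker A B L" and wz: "weakly_converges w z"
  proof (rule opial[OF \<open>kuhn_tucker A B L \<noteq> {}\<close> dist_conv])
    fix r :: "nat \<Rightarrow> nat" and z assume r: "strict_mono r" and wr: "weakly_converges (w \<circ> r) z"
    obtain y q where yq: "z = (y, q)" by (cases z)
    have xr: "weakly_converges (x \<circ> r) y" and vr: "weakly_converges (v \<circ> r) q"
      using wr by (simp_all add: yq w_def comp_def weakly_converges_Pair_iff)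
    have "(y, q) \<in> kuhn_tucker A B L"
    proof (rule kuhn_tucker_weakly_closed[OF A B L])
      show "(s \<circ> r) n - adjoint L ((d \<circ> r) n) \<in> A ((a \<circ> r) n)" "(d \<circ> r) n \<in> B ((b \<circ> r) n)" for n
        using cA dB by simp_all
      show "bounded (range (a \<circ> r))" "bounded (range (d \<circ> r))"
        using bdd by (auto intro: bounded_subset)
      show "weakly_converges (a \<circ> r) y"
        using weakly_converges_add_null[OF xr LIMSEQ_subseq_LIMSEQ[OF ax0 r]] by (simp add: comp_def)
      show "weakly_converges (d \<circ> r) q"
        using weakly_converges_add_null[OF vr LIMSEQ_subseq_LIMSEQ[OF dv0 r]] by (simp add: comp_def)
      show "(\<lambda>n. (s \<circ> r) n - adjoint L ((d \<circ> r) n) + adjoint L ((d \<circ> r) n)) \<longlonglongrightarrow> 0"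
        using LIMSEQ_subseq_LIMSEQ[OF summable_norm_square_imp_null[OF sum_s] r] by (simp add: comp_def)
      show "(\<lambda>n. (b \<circ> r) n - L ((a \<circ> r) n)) \<longlonglongrightarrow> 0"
        using LIMSEQ_subseq_LIMSEQ[OF summable_norm_square_imp_null[OF sum_t] r]
        by (simp add: comp_def st(9))
    qed
    then show "z \<in> kuhn_tucker A B L" by (simp add: yq)
  qed blast
  obtain xbar vbar where "z = (xbar, vbar)" by (cases z)
  with wz z have "weakly_converges x xbar" "weakly_converges v vbar" "(xbar, vbar) \<in> kuhn_tucker A B L"
    by (auto simp: w_def[abs_def] weakly_converges_Pair_iff)
  then have "\<exists>xbar vbar. weakly_converges x xbar \<and> xbar \<in> primal_solutions A B L \<and>
             weakly_converges v vbar \<and> vbar \<in> dual_solutions A B L \<and>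
             (xbar, vbar) \<in> kuhn_tucker A B L"
    using kuhn_tucker_imp_primal kuhn_tucker_imp_dual by blast
  with True sum_s sum_t sum_xs sum_vs sum_xa sum_lb show ?thesis by (simp add: st(6))
qed

end
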